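(* Let $\mathbf{D}_{prior}\in\mathbb{C}^{N\times N}$ satisfy $\mathbf{D}_{prior}^H\mathbf{D}_{prior}=\mathbf{I}$, let $\mathbf{r}\in\mathbb{C}^{N\times1}$ and $j\in\{1,\dots,N\}$, and let $\mathbf{D}_{post}$ be the HOT posterior transform domain built from $\mathbf{D}_{prior}$, $\mathbf{r}$ and $j$ (defined in the context). Then the relative error and correlation between $\mathbf{D}_{post}$ and $\mathbf{D}_{prior}$ satisfy $$\mathcal{E}(\mathbf{D}_{post},\mathbf{D}_{prior})\le\frac{2}{\sqrt{N}},\qquad \rho(\mathbf{D}_{post},\mathbf{D}_{prior})\ge 1-\frac{2}{N},$$ where $$\mathcal{E}(\mathbf{D}_{post},\mathbf{D}_{prior})=\frac{\|\mathbf{D}_{post}-\mathbf{D}_{prior}\|_{\mathrm F}}{\|\mathbf{D}_{prior}\|_{\mathrm F}},\qquad \rho(\mathbf{D}_{post},\mathbf{D}_{prior})=\frac1N\sum_{i=1}^{N}\frac{|\mathbf{D}_{post,i}^H\mathbf{D}_{prior,i}|}{\|\mathbf{D}_{post,i}\|_2\,\|\mathbf{D}_{prior,i}\|_2}.$$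
   Context: $(\cdot)^H$ denotes conjugate transpose, $\mathbf{e}_j$ is the $j$-th standard basis vector, $\|\cdot\|_{\mathrm F}$ is the Frobenius norm, and $\mathbf{D}_{prior,i}$, $\mathbf{D}_{post,i}$ are the $i$-th columns of $\mathbf{D}_{prior}$, $\mathbf{D}_{post}$. HOT (Householder Optimal Transformation): given a unitary $\mathbf{D}_{prior}$, a reference vector $\mathbf{r}\in\mathbb{C}^N$ and an index $j$, put $\mathbf{w}=\mathbf{D}_{prior}^H\mathbf{r}$ and let $\alpha\in\mathbb{C}$ be a scalar with $|\alpha|=\|\mathbf{r}\|_2$ and $\alpha\mathbf{w}^H\mathbf{e}_j\in\mathbb{R}$. If $\mathbf{r}=\alpha\mathbf{D}_{prior,j}$, then $\mathbf{D}_{post}=\mathbf{D}_{prior}$. Otherwise $$\mathbf{D}_{post}=\mathbf{D}_{prior}-\frac{2}{\|\mathbf{w}-\alpha\mathbf{e}_j\|_2^2}(\mathbf{r}-\alpha\mathbf{D}_{prior,j})(\mathbf{w}-\alpha\mathbf{e}_j)^H .$$ *)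

theory Defs
  imports "HOL-Analysis.Analysis"
begin

text \<open>
  Matrices are rectangular families \<open>complex ^ 'n ^ 'm\<close> with rows indexed by \<open>'m\<close>.
  The norm of a vector \<open>complex ^ 'n\<close> is its Euclidean norm, and the norm of a matrix (a vector
  of row vectors) is its Frobenius norm, see \<open>norm_matrix_eq_frobenius\<close>.
\<close>

definition conj_transpose :: "complex ^ 'n ^ 'm \<Rightarrow> complex ^ 'm ^ 'n"
  where "conj_transpose A = (\<chi> i k. cnj (A $ k $ i))"

text \<open>The scalar \<open>x\<^sup>H y\<close>; the library's inner product on \<open>complex ^ 'n\<close> is only its real part.\<close>

definition conj_dot :: "complex ^ 'n \<Rightarrow> complex ^ 'n \<Rightarrow> complex"
  where "conj_dot x y = (\<Sum>i\<in>UNIV. cnj (x $ i) * y $ i)"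

text \<open>The rank-one matrix \<open>x y\<^sup>H\<close>.\<close>

definition conj_outer :: "complex ^ 'm \<Rightarrow> complex ^ 'n \<Rightarrow> complex ^ 'n ^ 'm"
  where "conj_outer x y = (\<chi> i k. x $ i * cnj (y $ k))"

lemma norm_matrix_eq_frobenius:
  fixes A :: "complex ^ 'n ^ 'm"
  shows "norm A = sqrt (\<Sum>i\<in>UNIV. \<Sum>k\<in>UNIV. (cmod (A $ i $ k))\<^sup>2)"
  by (simp add: norm_vec_def L2_set_def sum_nonneg)

text \<open>
  The scalar \<open>\<alpha>\<close> of the Householder transformation is not unique (its sign, and its whole phase
  when \<open>w\<^sup>H e\<^sub>j = 0\<close>, are free), so it is kept as a parameter subject to this condition.
\<close>

definition hot_scalar :: "complex ^ 'n ^ 'n \<Rightarrow> complex ^ 'n \<Rightarrow> 'n \<Rightarrow> complex \<Rightarrow> bool"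
  where "hot_scalar D r j \<alpha> \<longleftrightarrow>
    cmod \<alpha> = norm r \<and> \<alpha> * conj_dot (conj_transpose D *v r) (axis j 1) \<in> \<real>"

definition hot_post :: "complex ^ 'n ^ 'n \<Rightarrow> complex ^ 'n \<Rightarrow> 'n \<Rightarrow> complex \<Rightarrow> complex ^ 'n ^ 'n"
  where "hot_post D r j \<alpha> =
    (if r = \<alpha> *s column j D then D
     else let w = conj_transpose D *v r; v = w - \<alpha> *s axis j 1 in
       D - (2 / (norm v)\<^sup>2) *\<^sub>R conj_outer (r - \<alpha> *s column j D) v)"

definition relative_error :: "complex ^ 'n ^ 'n \<Rightarrow> complex ^ 'n ^ 'n \<Rightarrow> real"
  where "relative_error A B = norm (A - B) / norm B"

definition correlation :: "complex ^ 'n ^ 'n \<Rightarrow> complex ^ 'n ^ 'n \<Rightarrow> real"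
  where "correlation A B = (1 / real CARD('n)) *
    (\<Sum>i\<in>UNIV. cmod (conj_dot (column i A) (column i B)) / (norm (column i A) * norm (column i B)))"

end

theory Submission
  imports Defs
begin

text \<open>
  Put \<open>v = D\<^sup>H r - \<alpha> e\<^sub>j\<close>.  Since a square isometry \<open>D\<close> is also a co-isometry,
  \<open>D v = r - \<alpha> D e\<^sub>j\<close>, so the posterior domain is \<open>D H\<close> for the Householder reflection
  \<open>H = I - 2 v v\<^sup>H / \<parallel>v\<parallel>\<^sup>2\<close> (\<open>hot_post_eq_reflection\<close>).  Norms and inner products are
  invariant under the isometry \<open>D\<close>, so both bounds reduce to elementary properties of \<open>H\<close>.

  The perturbation \<open>D H - D\<close> is the rank-one matrix \<open>-2 (D v) v\<^sup>H / \<parallel>v\<parallel>\<^sup>2\<close>, whose Frobenius norm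
  is at most \<open>2\<close>, while \<open>\<parallel>D\<parallel> = \<surd>N\<close>.  For the correlation, all columns of \<open>D H\<close> and \<open>D\<close> are
  unit vectors, and the \<open>i\<close>-th inner product is the diagonal entry
  \<open>1 - 2 \<bar>v\<^sub>i\<bar>\<^sup>2 / \<parallel>v\<parallel>\<^sup>2\<close> of \<open>H\<close>.  Discarding the absolute values leaves the trace of \<open>H\<close>,
  which is at least \<open>N - 2\<close>.
\<close>

lemma sum_cmod_squared: "(\<Sum>i\<in>UNIV. (cmod (x $ i))\<^sup>2) = (norm x)\<^sup>2"
  by (simp add: norm_vec_def L2_set_def sum_nonneg)

lemma conj_dot_self: "conj_dot x x = of_real ((norm x)\<^sup>2)"
  by (simp add: conj_dot_def mult.commute[of "cnj _"]
      flip: complex_norm_square sum_cmod_squared)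

lemma norm_conj_outer: "norm (conj_outer x y) = norm x * norm y"
  by (simp add: norm_matrix_eq_frobenius conj_outer_def norm_mult power_mult_distrib
      real_sqrt_mult sum_cmod_squared flip: sum_product sum_distrib_left sum_distrib_right)

lemma conj_dot_matrix_vector_left:
  "conj_dot (A *v x) y = conj_dot x (conj_transpose A *v y)"
  unfolding conj_dot_def conj_transpose_def matrix_vector_mult_def
  apply (simp add: sum_distrib_left sum_distrib_right mult_ac)
  by (rule sum.swap)

lemma conj_dot_isometry:
  assumes "conj_transpose A ** A = mat 1"
  shows "conj_dot (A *v x) (A *v y) = conj_dot x y"
  by (simp add: conj_dot_matrix_vector_left matrix_vector_mul_assoc assms)

lemma norm_isometry:
  assumes "conj_transpose A ** A = mat 1"
  shows "norm (A *v x) = norm x"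
proof -
  have "(norm (A *v x))\<^sup>2 = (norm x)\<^sup>2"
    using conj_dot_isometry[OF assms, of x x]
    by (metis conj_dot_self of_real_eq_iff)
  then show ?thesis by simp
qed

lemma column_matrix_mult: "column i (A ** B) = A *v column i B"
  by (simp add: column_def matrix_matrix_mult_def matrix_vector_mult_def)

lemma column_eq_mult_axis: "column i A = A *v axis i (1::complex)"
  by (simp add: vec_eq_iff column_def matrix_vector_mult_def axis_def if_distrib cong: if_cong)

lemma norm_column_isometry:
  assumes "conj_transpose A ** A = mat 1"
  shows "norm (column i A) = 1"
  by (simp add: column_eq_mult_axis norm_isometry[OF assms])

lemma frobenius_norm_isometry:
  fixes A :: "complex ^ 'n ^ 'n"
  assumes "conj_transpose A ** A = mat 1"
  shows "norm A = sqrt (real CARD('n))"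
proof -
  have "(\<Sum>i\<in>UNIV. \<Sum>k\<in>UNIV. (cmod (A $ i $ k))\<^sup>2) = (\<Sum>k\<in>UNIV. (norm (column k A))\<^sup>2)"
    by (subst sum.swap) (simp add: column_def flip: sum_cmod_squared)
  then show ?thesis
    by (simp add: norm_matrix_eq_frobenius norm_column_isometry[OF assms])
qed

text \<open>
  For \<open>v = 0\<close> the convention \<open>2 / 0 = 0\<close> makes this the identity matrix, which is exactly the
  degenerate branch of the transformation; hence both branches are the same product with \<open>D\<close>.
\<close>

definition householder :: "complex ^ 'n \<Rightarrow> complex ^ 'n ^ 'n"
  where "householder v = mat 1 - (2 / (norm v)\<^sup>2) *\<^sub>R conj_outer v v"

lemma column_householder:
  "column i (householder v) = axis i 1 - (of_real (2 / (norm v)\<^sup>2) * cnj (v $ i)) *s v"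
  by (simp add: vec_eq_iff column_def householder_def conj_outer_def mat_def axis_def
      scaleR_conv_of_real[where 'a = complex])

lemma conj_dot_axis: "conj_dot x (axis i 1) = cnj (x $ i)"
  by (simp add: conj_dot_def axis_def if_distrib cong: if_cong)

lemma conj_dot_column_householder_axis:
  "conj_dot (column i (householder v)) (axis i 1)
    = of_real (1 - 2 * (cmod (v $ i))\<^sup>2 / (norm v)\<^sup>2)"
  by (simp add: conj_dot_axis column_householder mult.assoc flip: complex_norm_square)

text \<open>
  The reflected vector \<open>e\<^sub>i - c v\<close> has squared length \<open>1 - 4 \<bar>v\<^sub>i\<bar>\<^sup>2 / \<parallel>v\<parallel>\<^sup>2 + 4 \<bar>v\<^sub>i\<bar>\<^sup>2 / \<parallel>v\<parallel>\<^sup>2\<close>: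
  the factor \<open>2\<close> of the reflection makes the cross term and the quadratic term cancel.
\<close>

lemma norm_column_householder: "norm (column i (householder v)) = 1"
proof (cases "v = 0")
  case True
  then show ?thesis by (simp add: column_householder)
next
  case False
  define c where "c = complex_of_real (2 / (norm v)\<^sup>2) * cnj (v $ i)"
  have sq: "conj_dot (x - a *s y) (x - a *s y) = conj_dot x x - a * conj_dot x y
      - cnj a * conj_dot y x + cnj a * a * conj_dot y y" for x y :: "complex ^ 'a" and a
    by (simp add: conj_dot_def algebra_simps sum.distrib sum_subtractf sum_distrib_left)
  have "conj_dot (axis i 1) v = v $ i"
    by (simp add: conj_dot_def axis_def if_distrib if_distribR cong: if_cong)
  then have "conj_dot (column i (householder v)) (column i (householder v))
      = 1 - c * v $ i - cnj c * cnj (v $ i) + cnj c * c * of_real ((norm v)\<^sup>2)"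
    unfolding column_householder c_def[symmetric] sq
    by (simp add: conj_dot_axis conj_dot_self[of v])
  also have "\<dots> = 1"
    using False by (simp add: c_def field_simps power2_eq_square)
  finally have "complex_of_real ((norm (column i (householder v)))\<^sup>2) = 1"
    by (simp only: conj_dot_self)
  then have "(norm (column i (householder v)))\<^sup>2 = 1"
    by (simp only: of_real_eq_1_iff)
  then show ?thesis
    by (metis norm_ge_zero one_power2 power2_eq_iff_nonneg zero_le_one)
qed

lemma matrix_mult_householder:
  "A ** householder v = A - (2 / (norm v)\<^sup>2) *\<^sub>R conj_outer (A *v v) v"
proof -
  have "A ** (c *\<^sub>R conj_outer v v) = c *\<^sub>R conj_outer (A *v v) v" for c
    by (simp add: vec_eq_iff conj_outer_def matrix_matrix_mult_def matrix_vector_mult_def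
        sum_distrib_right mult.assoc scaleR_sum_right)
  moreover have "A ** (B - C) = A ** B - A ** C" for B C :: "complex ^ 'a ^ 'a"
    by (simp add: vec_eq_iff matrix_matrix_mult_def right_diff_distrib sum_subtractf)
  ultimately show ?thesis
    by (simp add: householder_def)
qed

text \<open>
  For square matrices the left inverse \<open>D\<^sup>H\<close> is also a right inverse, so \<open>D D\<^sup>H r = r\<close>; this is
  what lets \<open>D\<close> be factored out of the rank-one update.
\<close>

lemma hot_post_eq_reflection:
  assumes "conj_transpose D ** D = mat 1"
  shows "hot_post D r j \<alpha> = D ** householder (conj_transpose D *v r - \<alpha> *s axis j 1)"
proof -
  define v where "v = conj_transpose D *v r - \<alpha> *s axis j 1"
  have "D ** conj_transpose D = mat 1"
    using assms matrix_left_right_inverse by blast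
  then have Dv: "D *v v = r - \<alpha> *s column j D"
    by (simp add: v_def matrix_vector_mult_diff_distrib matrix_vector_mul_assoc
        vector_scalar_commute column_eq_mult_axis)
  have "v = 0" if "r = \<alpha> *s column j D"
    using norm_isometry[OF assms, of v] that by (simp add: Dv)
  then show ?thesis
    using Dv by (auto simp: hot_post_def matrix_mult_householder Let_def simp flip: v_def)
qed

lemma relative_error_reflection_le:
  fixes D :: "complex ^ 'n ^ 'n"
  assumes "conj_transpose D ** D = mat 1"
  shows "relative_error (D ** householder v) D \<le> 2 / sqrt (real CARD('n))"
proof -
  have "norm (D ** householder v - D) \<le> 2"
    by (simp add: matrix_mult_householder norm_conj_outer norm_isometry[OF assms]
        power2_eq_square)
  then show ?thesis
    by (simp add: relative_error_def frobenius_norm_isometry[OF assms] divide_right_mono)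
qed

lemma correlation_reflection_ge:
  fixes D :: "complex ^ 'n ^ 'n"
  assumes "conj_transpose D ** D = mat 1"
  shows "correlation (D ** householder v) D \<ge> 1 - 2 / real CARD('n)"
proof -
  have dot: "conj_dot (column i (D ** householder v)) (column i D)
      = of_real (1 - 2 * (cmod (v $ i))\<^sup>2 / (norm v)\<^sup>2)" for i
    unfolding column_matrix_mult column_eq_mult_axis[of i D] conj_dot_isometry[OF assms]
    by (rule conj_dot_column_householder_axis)
  have norm_post: "norm (column i (D ** householder v)) = 1" for i
    by (simp add: column_matrix_mult norm_isometry[OF assms] norm_column_householder)
  \<comment> \<open>The trace of the reflection is \<open>N - 2\<close>, or \<open>N\<close> when \<open>v = 0\<close>.\<close>
  have "real CARD('n) - 2 \<le> real CARD('n) - 2 * (norm v)\<^sup>2 / (norm v)\<^sup>2"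
    by simp
  also have "\<dots> = (\<Sum>i\<in>UNIV. 1 - 2 * (cmod (v $ i))\<^sup>2 / (norm v)\<^sup>2)"
    by (simp add: sum_subtractf sum_cmod_squared flip: sum_divide_distrib sum_distrib_left)
  also have "\<dots> \<le> (\<Sum>i\<in>UNIV. cmod (conj_dot (column i (D ** householder v)) (column i D)))"
    unfolding dot norm_of_real by (intro sum_mono abs_ge_self)
  finally have "(real CARD('n) - 2) / real CARD('n) \<le> correlation (D ** householder v) D"
    by (simp add: correlation_def norm_post norm_column_isometry[OF assms] divide_right_mono)
  then show ?thesis
    by (simp add: diff_divide_distrib)
qed

theorem theorem2:
  fixes D_prior D_post :: "complex ^ 'n ^ 'n" and r :: "complex ^ 'n" and j :: 'n
    and \<alpha> :: complex
  assumes "conj_transpose D_prior ** D_prior = mat 1"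
    and "hot_scalar D_prior r j \<alpha>"
    and "D_post = hot_post D_prior r j \<alpha>"
  shows "relative_error D_post D_prior \<le> 2 / sqrt (real CARD('n)) \<and>
    correlation D_post D_prior \<ge> 1 - 2 / real CARD('n)"
  unfolding assms(3) hot_post_eq_reflection[OF assms(1)]
  using relative_error_reflection_le[OF assms(1)] correlation_reflection_ge[OF assms(1)]
  by blast

end
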